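(* Let $c$, $k$ and $\omega$ be positive integers with $ck - 3\omega + 1 > 0$ and $\omega > k$. Let $H$ be a finite chordal graph with clique number $\omega(H)=\omega$. Then in the $k$-clique-relaxed coloring game on $H$ with $c$ colors, Alice wins by playing the Activation Strategy with respect to a simplicial ordering of $V(H)$. Consequently, $\chi_{\mathrm{g}}^{(k)}(H) \le \left\lfloor \frac{3\omega-1}{k}\right\rfloor + 1$.
   Context: The $k$-clique-relaxed $n$-coloring game on a finite graph $G$: there is a fixed set of $n$ colors; Alice moves first, and Alice and Bob alternately choose an uncolored vertex and assign it one of the $n$ colors, subject to the rule that at no point may there be a monochromatic clique on $k+1$ vertices. Alice wins if the game ends with all vertices colored; Bob wins if at some point an uncolored vertex has no legal color. $\chi_{\mathrm{g}}^{(k)}(G)$ is the least $n$ such that Alice has a winning strategy. A graph is chordal if it has no induced cycle of length at least 4. Ordering notions: for a linear ordering $\mathcal{L}$ of $V(G)$, write $x<y$ if $x$ precedes $y$; the parents of $v$ are its neighbors $x<v$, forming $N^+(v)$, and $N^+[v]=N^+(v)\cup\{v\}$. A simplicial ordering is one in which $N^+[v]$ induces a clique for every $v$ (chordal graphs admit such orderings). Activation Strategy (with respect to $\mathcal{L}$): Alice maintains a set of active vertices, initially empty; every vertex is activated before or when it is colored. At any moment, the mother $m(x)$ of a vertex $x$ is the least (in $\mathcal{L}$) uncolored vertex of $N^+[x]$, if one exists. On her first move Alice activates and colors the least vertex of $\mathcal{L}$. After Bob colors a vertex $b$, Alice activates $b$ (if not already active) and then: if $m(b)$ does not exist, she colors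 the least uncolored vertex of $\mathcal{L}$ (activating it); otherwise she sets $x:=m(b)$ and repeats: if $x$ is inactive, she activates $x$ and sets $x:=m(x)$; if $x$ is active, she colors $x$. Whenever she colors a vertex she uses any legal color. *)

theory Defs
  imports Complex_Main
begin

definition simple_graph :: "'a set \<Rightarrow> ('a \<times> 'a) set \<Rightarrow> bool" where
  "simple_graph V E \<longleftrightarrow> E \<subseteq> V \<times> V \<and> sym E \<and> irrefl E"

definition clique :: "'a set \<Rightarrow> ('a \<times> 'a) set \<Rightarrow> 'a set \<Rightarrow> bool" where
  "clique V E S \<longleftrightarrow> S \<subseteq> V \<and> (\<forall>x\<in>S. \<forall>y\<in>S. x \<noteq> y \<longrightarrow> (x, y) \<in> E)"

definition clique_number :: "'a set \<Rightarrow> ('a \<times> 'a) set \<Rightarrow> nat" where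
  "clique_number V E = Max (card ` {S. clique V E S})"

definition induced_cycle :: "'a set \<Rightarrow> ('a \<times> 'a) set \<Rightarrow> 'a list \<Rightarrow> bool" where
  "induced_cycle V E vs \<longleftrightarrow> length vs \<ge> 3 \<and> distinct vs \<and> set vs \<subseteq> V \<and>
     (\<forall>i<length vs. \<forall>j<length vs. (vs ! i, vs ! j) \<in> E \<longleftrightarrow>
        j = Suc i mod length vs \<or> i = Suc j mod length vs)"

definition chordal :: "'a set \<Rightarrow> ('a \<times> 'a) set \<Rightarrow> bool" where
  "chordal V E \<longleftrightarrow> \<not> (\<exists>vs. induced_cycle V E vs \<and> length vs \<ge> 4)"

definition parents :: "('a \<times> 'a) set \<Rightarrow> ('a \<times> 'a) set \<Rightarrow> 'a \<Rightarrow> 'a set" where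
  "parents E L v = {x. (x, v) \<in> E \<and> (x, v) \<in> L \<and> x \<noteq> v}"

definition simplicial_ordering :: "'a set \<Rightarrow> ('a \<times> 'a) set \<Rightarrow> ('a \<times> 'a) set \<Rightarrow> bool" where
  "simplicial_ordering V E L \<longleftrightarrow>
     linear_order_on V L \<and> (\<forall>v\<in>V. clique V E (insert v (parents E L v)))"

text \<open>
  The colours of the game with \<open>n\<close> colours are the naturals below \<open>n\<close>. A history is the
  chronological list of moves (vertex, colour); Alice makes the moves at even positions.
  No vertex is coloured twice in a play, so \<open>map_of\<close> yields the current partial colouring.
\<close>

type_synonym 'a history = "('a \<times> nat) list"

definition monochromatic_clique ::
    "'a set \<Rightarrow> ('a \<times> 'a) set \<Rightarrow> ('a \<Rightarrow> nat option) \<Rightarrow> 'a set \<Rightarrow> bool" where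
  "monochromatic_clique V E f S \<longleftrightarrow> clique V E S \<and> (\<exists>d. \<forall>x\<in>S. f x = Some d)"

definition legal_move ::
    "'a set \<Rightarrow> ('a \<times> 'a) set \<Rightarrow> nat \<Rightarrow> nat \<Rightarrow> 'a history \<Rightarrow> 'a \<times> nat \<Rightarrow> bool" where
  "legal_move V E k n h = (\<lambda>(v, d). v \<in> V \<and> map_of h v = None \<and> d < n \<and>
     \<not> (\<exists>S. monochromatic_clique V E ((map_of h)(v \<mapsto> d)) S \<and> card S = k + 1))"

definition uncolored :: "'a set \<Rightarrow> 'a history \<Rightarrow> 'a set" where
  "uncolored V h = {v \<in> V. map_of h v = None}"

definition bob_won :: "'a set \<Rightarrow> ('a \<times> 'a) set \<Rightarrow> nat \<Rightarrow> nat \<Rightarrow> 'a history \<Rightarrow> bool" where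
  "bob_won V E k n h \<longleftrightarrow> (\<exists>v\<in>uncolored V h. \<not> (\<exists>d. legal_move V E k n h (v, d)))"

definition alice_won :: "'a set \<Rightarrow> 'a history \<Rightarrow> bool" where
  "alice_won V h \<longleftrightarrow> uncolored V h = {}"

definition finished :: "'a set \<Rightarrow> ('a \<times> 'a) set \<Rightarrow> nat \<Rightarrow> nat \<Rightarrow> 'a history \<Rightarrow> bool" where
  "finished V E k n h \<longleftrightarrow> alice_won V h \<or> bob_won V E k n h"

inductive play :: "'a set \<Rightarrow> ('a \<times> 'a) set \<Rightarrow> nat \<Rightarrow> nat \<Rightarrow> 'a history \<Rightarrow> bool"
  for V E k n where
  "play V E k n []"
| "play V E k n h \<Longrightarrow> \<not> finished V E k n h \<Longrightarrow> legal_move V E k n h m \<Longrightarrow>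
     play V E k n (h @ [m])"

definition follows :: "('a history \<Rightarrow> 'a \<times> nat) \<Rightarrow> 'a history \<Rightarrow> bool" where
  "follows \<sigma> h \<longleftrightarrow> (\<forall>i<length h. even i \<longrightarrow> h ! i = \<sigma> (take i h))"

text \<open>
  Every move colours a new vertex, so on a finite graph every play reaches a finished
  history as long as Alice always has a legal move to make.
\<close>

definition winning_strategy ::
    "'a set \<Rightarrow> ('a \<times> 'a) set \<Rightarrow> nat \<Rightarrow> nat \<Rightarrow> ('a history \<Rightarrow> 'a \<times> nat) \<Rightarrow> bool" where
  "winning_strategy V E k n \<sigma> \<longleftrightarrow> (\<forall>h. play V E k n h \<and> follows \<sigma> h \<longrightarrow>
     (even (length h) \<and> \<not> finished V E k n h \<longrightarrow> legal_move V E k n h (\<sigma> h)) \<and>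
     (finished V E k n h \<longrightarrow> alice_won V h))"

definition game_chromatic_number :: "nat \<Rightarrow> 'a set \<Rightarrow> ('a \<times> 'a) set \<Rightarrow> nat" where
  "game_chromatic_number k V E = (LEAST n. \<exists>\<sigma>. winning_strategy V E k n \<sigma>)"

definition least_of :: "('a \<times> 'a) set \<Rightarrow> 'a set \<Rightarrow> 'a \<Rightarrow> bool" where
  "least_of L S x \<longleftrightarrow> x \<in> S \<and> (\<forall>y\<in>S. (x, y) \<in> L)"

text \<open>
  In the following, \<open>U\<close> is the current set of uncoloured vertices. The mother of \<open>x\<close> exists
  iff \<open>mother_candidates E L U x\<close> is nonempty.
\<close>

definition mother_candidates ::
    "('a \<times> 'a) set \<Rightarrow> ('a \<times> 'a) set \<Rightarrow> 'a set \<Rightarrow> 'a \<Rightarrow> 'a set" where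
  "mother_candidates E L U x = insert x (parents E L x) \<inter> U"

definition is_mother ::
    "('a \<times> 'a) set \<Rightarrow> ('a \<times> 'a) set \<Rightarrow> 'a set \<Rightarrow> 'a \<Rightarrow> 'a \<Rightarrow> bool" where
  "is_mother E L U x m \<longleftrightarrow> least_of L (mother_candidates E L U x) m"

text \<open>
  \<open>chase E L U A x A' y\<close>: Alice's loop, entered at \<open>x\<close> with active set \<open>A\<close>, ends with her
  colouring \<open>y\<close> and with active set \<open>A'\<close>.
\<close>

inductive chase :: "('a \<times> 'a) set \<Rightarrow> ('a \<times> 'a) set \<Rightarrow> 'a set \<Rightarrow>
    'a set \<Rightarrow> 'a \<Rightarrow> 'a set \<Rightarrow> 'a \<Rightarrow> bool"
  for E L U where
  active: "x \<in> A \<Longrightarrow> chase E L U A x A x"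
| inactive: "x \<notin> A \<Longrightarrow> is_mother E L U x m \<Longrightarrow> chase E L U (insert x A) m A' y \<Longrightarrow>
     chase E L U A x A' y"

text \<open>
  \<open>activation_run V E L h A\<close>: the last move of \<open>h\<close> is Alice's, all vertices she coloured in
  \<open>h\<close> are those prescribed by the Activation Strategy, and \<open>A\<close> is the resulting active set.
  The colours are left free; their legality is imposed separately.
\<close>

inductive activation_run :: "'a set \<Rightarrow> ('a \<times> 'a) set \<Rightarrow> ('a \<times> 'a) set \<Rightarrow>
    'a history \<Rightarrow> 'a set \<Rightarrow> bool"
  for V E L where
  first: "least_of L V v \<Longrightarrow> activation_run V E L [(v, d)] {v}"
| no_mother: "activation_run V E L h A \<Longrightarrow> U = uncolored V (h @ [(b, e)]) \<Longrightarrow>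
     mother_candidates E L U b = {} \<Longrightarrow> least_of L U v \<Longrightarrow>
     activation_run V E L (h @ [(b, e), (v, d)]) (insert v (insert b A))"
| mother: "activation_run V E L h A \<Longrightarrow> U = uncolored V (h @ [(b, e)]) \<Longrightarrow>
     is_mother E L U b x \<Longrightarrow> chase E L U (insert b A) x A' y \<Longrightarrow>
     activation_run V E L (h @ [(b, e), (y, d)]) A'"

text \<open>
  The Activation Strategy leaves the choice of a legal colour open, hence it is a property
  of strategies.
\<close>

definition activation_strategy :: "'a set \<Rightarrow> ('a \<times> 'a) set \<Rightarrow> nat \<Rightarrow> nat \<Rightarrow>
    ('a \<times> 'a) set \<Rightarrow> ('a history \<Rightarrow> 'a \<times> nat) \<Rightarrow> bool" where
  "activation_strategy V E k n L \<sigma> \<longleftrightarrow>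
     (\<forall>h. play V E k n h \<and> follows \<sigma> h \<and> even (length h) \<and> \<not> finished V E k n h \<longrightarrow>
        legal_move V E k n h (\<sigma> h) \<and> (\<exists>A. activation_run V E L (h @ [\<sigma> h]) A))"

text \<open>
  With one colour per vertex Alice wins, so the minimum in \<open>game_chromatic_number\<close> is
  attained.
\<close>

lemma play_no_monochromatic:
  assumes "play V E k n h" and "k > 0"
  shows "length h = card (dom (map_of h)) \<and> dom (map_of h) \<subseteq> V \<and>
    \<not> (\<exists>S. monochromatic_clique V E (map_of h) S \<and> card S = k + 1)"
  using assms(1)
proof (induction rule: play.induct)
  case 1
  have "S = {}" if "monochromatic_clique V E (map_of []) S" for S :: "'a set"
    using that by (auto simp: monochromatic_clique_def)
  then show ?case by fastforce
next
  case (2 h m)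
  obtain v d where m: "m = (v, d)" by fastforce
  have v: "v \<in> V" "map_of h v = None" using 2(3) by (auto simp: legal_move_def m)
  have eq: "map_of (h @ [m]) = (map_of h)(v \<mapsto> d)"
    using v by (auto simp: m map_add_def fun_eq_iff split: option.splits)
  have dom: "dom (map_of (h @ [m])) = insert v (dom (map_of h))" by (simp add: eq del: map_of_append)
  have "v \<notin> dom (map_of h)" using v by auto
  then have "card (dom (map_of (h @ [m]))) = length (h @ [m])"
    unfolding dom using 2(4) by (simp add: finite_dom_map_of)
  moreover have "dom (map_of (h @ [m])) \<subseteq> V" unfolding dom using 2(4) v by blast
  moreover have "\<not> (\<exists>S. monochromatic_clique V E (map_of (h @ [m])) S \<and> card S = k + 1)"
    unfolding eq using 2(3) by (simp add: legal_move_def m)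
  ultimately show ?case by presburger
qed

lemma not_bob_won_card:
  assumes "finite V" and "k > 0" and p: "play V E k (card V) h"
  shows "\<not> bob_won V E k (card V) h"
proof
  assume "bob_won V E k (card V) h"
  then obtain v where v: "v \<in> V" "map_of h v = None"
    and stuck: "\<And>d. \<not> legal_move V E k (card V) h (v, d)"
    by (auto simp: bob_won_def uncolored_def)
  note inv = play_no_monochromatic[OF p \<open>k > 0\<close>]
  have "dom (map_of h) \<subset> V" using inv v by auto
  then have "card (dom (map_of h)) < card V" using \<open>finite V\<close> psubset_card_mono by blast
  then have "length h < card V" using inv by simp
  moreover have "card (snd ` set h) \<le> length h"
    by (metis card_length image_set length_map)
  ultimately have "\<not> {..<card V} \<subseteq> snd ` set h"
    by (metis List.finite_set card_lessThan card_mono finite_imageI leD le_trans)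
  then obtain d where d: "d < card V" "d \<notin> snd ` set h" by auto
  then have unused: "map_of h x \<noteq> Some d" for x
    by (metis image_eqI map_of_SomeD snd_conv)
  obtain S where S: "monochromatic_clique V E ((map_of h)(v \<mapsto> d)) S" "card S = k + 1"
    using stuck[of d] v d by (auto simp: legal_move_def)
  then obtain e where e: "clique V E S" "\<forall>x\<in>S. ((map_of h)(v \<mapsto> d)) x = Some e"
    by (auto simp: monochromatic_clique_def)
  show False
  proof (cases "v \<in> S")
    case True
    then have "e = d" using e by auto
    then have "S \<subseteq> {v}" using e unused by (auto split: if_splits)
    then have "card S \<le> 1" by (metis card_mono finite.emptyI finite.insertI is_singletonI is_singleton_altdef)
    then show False using S \<open>k > 0\<close> by simp
  next
    case False
    then have "monochromatic_clique V E (map_of h) S"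
      using e by (auto simp: monochromatic_clique_def intro!: exI[of _ e] split: if_splits)
    then show False using inv S by blast
  qed
qed

lemma winning_strategy_card:
  assumes "finite V" and "k > 0"
  shows "\<exists>\<sigma>. winning_strategy V E k (card V) \<sigma>"
proof
  let ?n = "card V"
  let ?s = "\<lambda>h. SOME m. legal_move V E k ?n h m"
  have "legal_move V E k ?n h (?s h)" if nf: "\<not> finished V E k ?n h" for h
  proof -
    obtain v where "v \<in> uncolored V h" using nf by (auto simp: finished_def alice_won_def)
    then obtain d where "legal_move V E k ?n h (v, d)"
      using nf by (auto simp: finished_def bob_won_def)
    then show ?thesis by (rule someI)
  qed
  then show "winning_strategy V E k ?n ?s"
    using not_bob_won_card[OF assms] by (auto simp: winning_strategy_def finished_def)
qed

lemma winning_strategy_game_chromatic_number: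
  assumes "finite V" and "k > 0"
  shows "\<exists>\<sigma>. winning_strategy V E k (game_chromatic_number k V E) \<sigma>"
  unfolding game_chromatic_number_def using winning_strategy_card[OF assms] by (rule LeastI)

end

theory Submission
  imports Defs
begin

text \<open>
  Dirac's theorem: let \<open>C\<close> be a component of the non-neighbours of a vertex \<open>x\<close>. Two nonadjacent
  vertices of its boundary would close up, through a shortest path in \<open>C\<close> and through \<open>x\<close>, to an
  induced cycle; so the boundary is a clique, and induction yields a simplicial vertex in \<open>C\<close>.
  Removing simplicial vertices one at a time gives a simplicial ordering.

  The game: when a child \<open>x\<close> of an uncoloured vertex \<open>v\<close> is activated, Alice next visits \<open>m(x)\<close>,
  which lies in \<open>N\<^sup>+[v]\<close> because \<open>N\<^sup>+[x]\<close> is a clique. A vertex is visited at most twice, and \<open>v\<close>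
  itself at most once while it is uncoloured. So after Alice's move \<open>v\<close> has at most
  \<open>2(\<omega> - 1) + 1\<close> active children, hence after Bob's reply at most
  \<open>(\<omega> - 1) + 2(\<omega> - 1) + 1 + 1 = 3\<omega> - 1 < ck\<close> coloured neighbours. An illegal colour for \<open>v\<close> needs
  \<open>k\<close> neighbours of that colour, so some colour is legal.
\<close>

section \<open>Simplicial orderings of chordal graphs\<close>

text \<open>Neighbours are quantified over \<open>V\<close>, so passing to an induced subgraph only
  shrinks the vertex set and leaves \<open>E\<close> fixed.\<close>

definition simplicial :: "'a set \<Rightarrow> ('a \<times> 'a) set \<Rightarrow> 'a \<Rightarrow> bool" where
  "simplicial V E v \<longleftrightarrow> v \<in> V \<and>
     (\<forall>a\<in>V. \<forall>b\<in>V. (v, a) \<in> E \<and> (v, b) \<in> E \<and> a \<noteq> b \<longrightarrow> (a, b) \<in> E)"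

lemma simplicialD:
  assumes "simplicial V E v" "a \<in> V" "b \<in> V" "(v, a) \<in> E" "(v, b) \<in> E" "a \<noteq> b"
  shows "(a, b) \<in> E"
  using assms unfolding simplicial_def by metis

lemma chordal_subset: "chordal V E \<Longrightarrow> W \<subseteq> V \<Longrightarrow> chordal W E"
  unfolding chordal_def induced_cycle_def by blast

text \<open>Take a walk of least length \<open>n\<close>. A repetition \<open>f i = f j\<close>
  would leave a walk of length \<open>i + (n - j)\<close>, and a chord from \<open>f i\<close> to
  \<open>f j\<close> one of length \<open>Suc i + (n - j)\<close>; minimality excludes the former
  and forces \<open>j = Suc i\<close> in the latter.\<close>

lemma shortest_walk:
  assumes "(u, w) \<in> R\<^sup>*"
  obtains n f where "f 0 = u" "f n = w" "\<And>i. i < n \<Longrightarrow> (f i, f (Suc i)) \<in> R"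
    "\<And>i j. i < j \<Longrightarrow> j \<le> n \<Longrightarrow> f i \<noteq> f j"
    "\<And>i j. i < j \<Longrightarrow> j \<le> n \<Longrightarrow> (f i, f j) \<in> R \<Longrightarrow> j = Suc i"
proof -
  define n where "n = (LEAST n. (u, w) \<in> R ^^ n)"
  have ex: "(u, w) \<in> R ^^ n"
    using assms unfolding n_def by (metis LeastI rtrancl_power)
  have min: "n \<le> m" if "(u, w) \<in> R ^^ m" for m
    unfolding n_def using that by (rule Least_le)
  obtain f where f: "f 0 = u" "f n = w" "\<And>i. i < n \<Longrightarrow> (f i, f (Suc i)) \<in> R"
    using ex unfolding relpow_fun_conv by blast
  have init: "(u, f i) \<in> R ^^ i" if "i \<le> n" for i
    unfolding relpow_fun_conv using f that by (intro exI[of _ f]) auto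
  have rest: "(f j, w) \<in> R ^^ (n - j)" if "j \<le> n" for j
    unfolding relpow_fun_conv using f that by (intro exI[of _ "\<lambda>t. f (t + j)"]) auto
  show ?thesis
  proof (rule that[OF f])
    fix i j assume ij: "i < j" "j \<le> n"
    show "f i \<noteq> f j"
    proof
      assume "f i = f j"
      then have "(u, w) \<in> R ^^ (i + (n - j))"
        unfolding relpow_add using init[of i] rest[of j] ij by auto
      then show False using min ij by fastforce
    qed
    assume "(f i, f j) \<in> R"
    then have "(u, w) \<in> R ^^ (Suc i + (n - j))"
      unfolding relpow_add using init[of i] rest[of j] ij by auto
    then show "j = Suc i" using min ij by fastforce
  qed
qed

text \<open>Closes a chordless path through an apex \<open>x\<close> adjacent only to its two ends.
  The apex has index 0 and \<open>f i\<close> has index \<open>Suc i\<close>, so the cycle has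
  length \<open>n + 2\<close>.\<close>

lemma induced_cycle_Cons_walk:
  assumes "sym E" "irrefl E" and V: "x \<in> V" "\<And>i. i \<le> n \<Longrightarrow> f i \<in> V" and n: "n \<ge> 2"
    and step: "\<And>i. i < n \<Longrightarrow> (f i, f (Suc i)) \<in> E"
    and inj: "\<And>i j. i < j \<Longrightarrow> j \<le> n \<Longrightarrow> f i \<noteq> f j"
    and ind: "\<And>i j. i < j \<Longrightarrow> j \<le> n \<Longrightarrow> (f i, f j) \<in> E \<Longrightarrow> j = Suc i"
    and x: "\<And>i. i \<le> n \<Longrightarrow> x \<noteq> f i" "\<And>i. i \<le> n \<Longrightarrow> (x, f i) \<in> E \<longleftrightarrow> i = 0 \<or> i = n"
  shows "induced_cycle V E (x # map f [0..<Suc n])"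
proof -
  let ?vs = "x # map f [0..<Suc n]"
  have len: "length ?vs = n + 2" by simp
  have nth0: "?vs ! 0 = x" by simp
  have nthS: "?vs ! Suc i = f i" if "i \<le> n" for i
    using that by (simp del: upt_Suc)
  have "inj_on f {0..<Suc n}"
    by (rule inj_onI) (metis atLeastLessThan_iff inj less_Suc_eq_le linorder_neqE_nat)
  then have dist: "distinct ?vs"
    using x(1) by (simp del: upt_Suc add: distinct_map less_Suc_eq_le image_iff)
  have sub: "set ?vs \<subseteq> V" using V by (auto simp: less_Suc_eq_le simp del: upt_Suc)
  have sE: "(a, b) \<in> E \<longleftrightarrow> (b, a) \<in> E" for a b using \<open>sym E\<close> by (auto dest: symD)
  have iE: "(a, a) \<notin> E" for a using \<open>irrefl E\<close> by (auto simp: irrefl_def)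
  have ff: "(f i, f j) \<in> E \<longleftrightarrow> j = Suc i \<or> i = Suc j" if "i \<le> n" "j \<le> n" for i j
    using that step[of i] step[of j] ind[of i j] ind[of j i] sE[of "f i" "f j"] iE[of "f i"]
    by (cases i j rule: linorder_cases) auto
  have md: "Suc i mod (n + 2) = (if i = n + 1 then 0 else Suc i)" if "i < n + 2" for i
    using that by auto
  have "(?vs ! i, ?vs ! j) \<in> E \<longleftrightarrow> j = Suc i mod (n + 2) \<or> i = Suc j mod (n + 2)"
    if ij: "i < n + 2" "j < n + 2" for i j
  proof (cases i)
    case 0
    show ?thesis
    proof (cases j)
      case 0
      then show ?thesis using \<open>i = 0\<close> iE by simp
    next
      case (Suc j')
      then have "?vs ! j = f j'" using nthS[of j'] ij by simp
      then show ?thesis using \<open>i = 0\<close> Suc x(2)[of j'] ij n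
        unfolding md[OF ij(1)] md[OF ij(2)] by auto
    qed
  next
    case (Suc i')
    then have i': "?vs ! i = f i'" using nthS[of i'] ij by simp
    show ?thesis
    proof (cases j)
      case 0
      then show ?thesis using Suc i' x(2)[of i'] ij n sE[of x "f i'"]
        unfolding md[OF ij(1)] md[OF ij(2)] by auto
    next
      case (Suc j')
      then have "?vs ! j = f j'" using nthS[of j'] ij by simp
      then show ?thesis using \<open>i = Suc i'\<close> Suc i' ff[of i' j'] ij
        unfolding md[OF ij(1)] md[OF ij(2)] by auto
    qed
  qed
  then show ?thesis unfolding induced_cycle_def len using dist sub n by auto
qed

text \<open>If \<open>u\<close> and \<open>w\<close> were nonadjacent, a shortest path between them
  through \<open>C\<close> would have length at least 2 and interior in \<open>C\<close>, hence away
  from the neighbours of \<open>x\<close>; with \<open>x\<close> it would form an induced cycle of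
  length at least 4.\<close>

lemma chordal_separator_adjacent:
  assumes "sym E" "irrefl E" "chordal V E" and sub: "x \<in> V" "u \<in> V" "w \<in> V" "C \<subseteq> V"
    and x: "x \<notin> C" "\<And>y. y \<in> C \<Longrightarrow> (x, y) \<notin> E" "(x, u) \<in> E" "(x, w) \<in> E"
    and con: "\<And>a b. a \<in> C \<Longrightarrow> b \<in> C \<Longrightarrow> (a, b) \<in> (E \<inter> C \<times> C)\<^sup>*"
    and att: "a \<in> C" "(u, a) \<in> E" "b \<in> C" "(w, b) \<in> E" and "u \<noteq> w"
  shows "(u, w) \<in> E"
proof (rule ccontr)
  assume nadj: "(u, w) \<notin> E"
  let ?D = "insert u (insert w C)"
  let ?R = "E \<inter> ?D \<times> ?D"
  have "(E \<inter> C \<times> C)\<^sup>* \<subseteq> ?R\<^sup>*" by (rule rtrancl_mono) auto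
  then have "(a, b) \<in> ?R\<^sup>*" using con att by blast
  moreover have "(u, a) \<in> ?R" using att by auto
  moreover have "(b, w) \<in> ?R" using att \<open>sym E\<close> by (auto dest: symD)
  ultimately have "(u, w) \<in> ?R\<^sup>*"
    by (meson converse_rtrancl_into_rtrancl rtrancl.rtrancl_into_rtrancl)
  then obtain n f where f: "f 0 = u" "f n = w" "\<And>i. i < n \<Longrightarrow> (f i, f (Suc i)) \<in> ?R"
    "\<And>i j. i < j \<Longrightarrow> j \<le> n \<Longrightarrow> f i \<noteq> f j"
    "\<And>i j. i < j \<Longrightarrow> j \<le> n \<Longrightarrow> (f i, f j) \<in> ?R \<Longrightarrow> j = Suc i"
    using shortest_walk[of u w ?R] by metis
  have "n \<noteq> 0" using f \<open>u \<noteq> w\<close> by metis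
  moreover have "n \<noteq> 1" using f(1,2) f(3)[of 0] nadj by auto
  ultimately have n: "n \<ge> 2" by simp
  have D: "f i \<in> ?D" if "i \<le> n" for i
    using f(2) f(3)[of i] that by (cases "i = n") auto
  have C: "f i \<in> C" if "0 < i" "i < n" for i
    using D[of i] f(4)[of 0 i] f(4)[of i n] f(1,2) that by auto
  have xu: "x \<noteq> u" "x \<noteq> w" using x \<open>irrefl E\<close> by (auto simp: irrefl_def)
  have "induced_cycle V E (x # map f [0..<Suc n])"
  proof (rule induced_cycle_Cons_walk[OF \<open>sym E\<close> \<open>irrefl E\<close> \<open>x \<in> V\<close> _ n])
    show "f i \<in> V" if "i \<le> n" for i using D[OF that] sub by auto
    show "(f i, f (Suc i)) \<in> E" if "i < n" for i using f(3)[OF that] by auto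
    show "f i \<noteq> f j" if "i < j" "j \<le> n" for i j using f(4) that .
    show "j = Suc i" if "i < j" "j \<le> n" "(f i, f j) \<in> E" for i j
      using f(5)[OF that(1,2)] that D[of i] D[of j] by auto
    show "x \<noteq> f i" if "i \<le> n" for i using D[OF that] xu x(1) by auto
    show "(x, f i) \<in> E \<longleftrightarrow> i = 0 \<or> i = n" if "i \<le> n" for i
      using C[of i] x f(1,2) that by (metis bot_nat_0.not_eq_extremum le_neq_implies_less)
  qed
  moreover have "length (x # map f [0..<Suc n]) \<ge> 4" using n by simp
  ultimately show False using \<open>chordal V E\<close> unfolding chordal_def by blast
qed

text \<open>Locating the simplicial vertex outside the closed neighbourhood of \<open>x\<close> is
  what makes the induction work: applied at a boundary vertex, it keeps the new vertex off the
  boundary clique.\<close>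

lemma ex_simplicial_nonadjacent:
  assumes "finite V" "sym E" "irrefl E" "chordal V E"
    and "x \<in> V" "z \<in> V" "z \<noteq> x" "(x, z) \<notin> E"
  shows "\<exists>v. simplicial V E v \<and> v \<noteq> x \<and> (x, v) \<notin> E"
  using assms(1,4-)
proof (induction arbitrary: x z rule: finite_psubset_induct)
  case (psubset V)
  note sE = \<open>sym E\<close>[THEN symD]
  have iE: "(a, a) \<notin> E" for a using \<open>irrefl E\<close> by (auto simp: irrefl_def)
  have ex: "\<exists>v. simplicial W E v" if W: "W \<subset> V" "a \<in> W" for W a
  proof (cases "\<exists>p\<in>W. \<exists>q\<in>W. q \<noteq> p \<and> (p, q) \<notin> E")
    case True
    then show ?thesis using psubset.IH[OF W(1)] chordal_subset[OF psubset.prems(1)] W by blast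
  next
    case False
    then show ?thesis using W unfolding simplicial_def by metis
  qed
  \<comment> \<open>\<open>W\<close> consists of the non-neighbours of \<open>x\<close>,
    \<open>C\<close> is the component of \<open>z\<close> in \<open>W\<close>, and \<open>S\<close>
    is the boundary of \<open>C\<close> in \<open>V\<close>.\<close>
  define W where "W = {y \<in> V. y \<noteq> x \<and> (x, y) \<notin> E}"
  define R where "R = E \<inter> W \<times> W"
  define C where "C = {y. (z, y) \<in> R\<^sup>*}"
  define S where "S = {s \<in> V - C. \<exists>y\<in>C. (s, y) \<in> E}"
  have zW: "z \<in> W" using psubset.prems by (auto simp: W_def)
  have zC: "z \<in> C" by (simp add: C_def)
  have CW: "y \<in> W" if "(z, y) \<in> R\<^sup>*" for y
    using that by (cases rule: rtranclE) (use zW in \<open>auto simp: R_def\<close>)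
  then have CW: "C \<subseteq> W" by (auto simp: C_def)
  have Cstep: "y \<in> C" if "a \<in> C" "(a, y) \<in> E" "y \<in> W" for a y
    using that CW by (auto simp: C_def R_def intro: rtrancl_into_rtrancl)
  \<comment> \<open>A walk in \<open>W\<close> starting at \<open>z\<close> never leaves
    \<open>C\<close>, so \<open>C\<close> is connected by edges inside itself.\<close>
  have "(z, y) \<in> (E \<inter> C \<times> C)\<^sup>*" if "(z, y) \<in> R\<^sup>*" for y
    using that
  proof (induction rule: rtrancl_induct)
    case base then show ?case by simp
  next
    case (step y y')
    then have "(y, y') \<in> E \<inter> C \<times> C"
      by (auto simp: C_def R_def intro: rtrancl_into_rtrancl[OF _ step.hyps(2)[unfolded R_def]])
    then show ?case using step.IH by (rule rtrancl_into_rtrancl[rotated])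
  qed
  then have zcon: "(z, y) \<in> (E \<inter> C \<times> C)\<^sup>*" if "y \<in> C" for y using that by (auto simp: C_def)
  have "sym (E \<inter> C \<times> C)" using sE by (auto simp: sym_def)
  then have "sym ((E \<inter> C \<times> C)\<^sup>*)" by (rule sym_rtrancl)
  then have con: "(a, b) \<in> (E \<inter> C \<times> C)\<^sup>*" if "a \<in> C" "b \<in> C" for a b
    using zcon[OF that(1)] zcon[OF that(2)] by (meson rtrancl_trans symD)
  have Sx: "(x, s) \<in> E" if sS: "s \<in> S" for s
  proof -
    obtain y where y: "s \<in> V" "s \<notin> C" "y \<in> C" "(s, y) \<in> E" using sS by (auto simp: S_def)
    then have "s \<notin> W" using Cstep[of y s] sE by blast
    moreover have "s \<noteq> x" using y CW by (auto simp: W_def)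
    ultimately show ?thesis using y by (auto simp: W_def)
  qed
  have Sclique: "(s, t) \<in> E" if st: "s \<in> S" "t \<in> S" "s \<noteq> t" for s t
  proof -
    obtain a b where "a \<in> C" "(s, a) \<in> E" "b \<in> C" "(t, b) \<in> E" using st by (auto simp: S_def)
    then show ?thesis
      using st CW Sx psubset.prems
      by (intro chordal_separator_adjacent[OF \<open>sym E\<close> \<open>irrefl E\<close> psubset.prems(1,2), of s t C a b] con)
        (auto simp: S_def W_def)
  qed
  \<comment> \<open>The inclusion is proper because \<open>x\<close> is missing from both
    \<open>C\<close> and \<open>S\<close>.\<close>
  have CS: "C \<union> S \<subset> V" using CW Sx iE psubset.prems by (auto simp: S_def W_def)
  \<comment> \<open>All neighbours in \<open>V\<close> of a vertex of \<open>C\<close> lie in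
    \<open>C\<close> or in its boundary, so simpliciality carries over to \<open>V\<close>.\<close>
  have lift: "simplicial V E v" if v: "v \<in> C" "simplicial (C \<union> S) E v" for v
  proof -
    have "a \<in> C \<union> S" if "a \<in> V" "(v, a) \<in> E" for a
      using that v sE by (auto simp: S_def)
    moreover have "v \<in> V" using v CW by (auto simp: W_def)
    ultimately show ?thesis using v(2) unfolding simplicial_def by blast
  qed
  have "\<exists>v\<in>C. simplicial (C \<union> S) E v"
  \<comment> \<open>If some \<open>s\<close> in \<open>S\<close> misses a vertex, induction at
    \<open>s\<close> gives a simplicial vertex not adjacent to \<open>s\<close>, hence outside the
    clique \<open>S\<close>. Otherwise \<open>S\<close> is joined to everything, and any simplicial
    vertex of \<open>C\<close> serves.\<close>
  proof (cases "\<exists>s\<in>S. \<exists>q\<in>C \<union> S. q \<noteq> s \<and> (s, q) \<notin> E")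
    case True
    then obtain s q where s: "s \<in> S" "q \<in> C \<union> S" "q \<noteq> s" "(s, q) \<notin> E" by blast
    obtain v where v: "simplicial (C \<union> S) E v" "v \<noteq> s" "(s, v) \<notin> E"
      using psubset.IH[OF CS _ _ s(2-)] chordal_subset[OF psubset.prems(1)] CS s(1) by blast
    have "v \<in> C \<union> S" using v(1) by (simp add: simplicial_def)
    then have "v \<in> C" using Sclique[OF s(1), of v] v(2,3) by blast
    then show ?thesis using v by blast
  next
    case False
    obtain v where v: "simplicial C E v" using ex[of C z] zC CS by blast
    have "(a, b) \<in> E" if "a \<in> C \<union> S" "b \<in> C \<union> S" "(v, a) \<in> E" "(v, b) \<in> E" "a \<noteq> b" for a b
    proof (cases "a \<in> C \<and> b \<in> C")
      case True
      then show ?thesis using simplicialD[OF v] that by metis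
    next
      case notC: False
      show ?thesis
      proof (cases "a \<in> S")
        case True
        then show ?thesis using False that by metis
      next
        case aS: False
        then have "b \<in> S" using notC that by blast
        then have "(b, a) \<in> E" using False that by metis
        then show ?thesis by (rule sE)
      qed
    qed
    then have "simplicial (C \<union> S) E v" using v by (simp add: simplicial_def)
    moreover have "v \<in> C" using v by (simp add: simplicial_def)
    ultimately show ?thesis by blast
  qed
  then obtain v where "v \<in> C" "simplicial V E v" using lift by blast
  then show ?case using CW by (auto simp: W_def)
qed

section \<open>From simplicial vertices to a simplicial ordering\<close>

lemma ex_simplicial:
  assumes "finite V" "sym E" "irrefl E" "chordal V E" "V \<noteq> {}"
  shows "\<exists>v. simplicial V E v"
proof (cases "\<exists>p\<in>V. \<exists>q\<in>V. q \<noteq> p \<and> (p, q) \<notin> E")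
  case True
  then show ?thesis using ex_simplicial_nonadjacent[OF assms(1-4)] by blast
next
  case False
  then show ?thesis using assms(5) unfolding simplicial_def by (metis ex_in_conv)
qed

lemma ex_simplicial_ordering:
  assumes "finite V" "sym E" "irrefl E" "chordal V E"
  shows "\<exists>L. simplicial_ordering V E L"
  using assms(1,4)
proof (induction rule: finite_psubset_induct)
  case (psubset V)
  show ?case
  proof (cases "V = {}")
    case True
    then show ?thesis
      by (intro exI[of _ "{}"])
        (auto simp: simplicial_ordering_def order_on_defs refl_on_def trans_def antisym_def total_on_def)
  next
    case False
    then obtain s where s: "simplicial V E s"
      using ex_simplicial[OF psubset.hyps \<open>sym E\<close> \<open>irrefl E\<close> psubset.prems] by blast
    let ?W = "V - {s}"
    have sV: "s \<in> V" using s by (simp add: simplicial_def)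
    then obtain L where L: "simplicial_ordering ?W E L"
      using psubset.IH[of ?W] chordal_subset[OF psubset.prems] by blast
    \<comment> \<open>The simplicial vertex \<open>s\<close> becomes the greatest element, so its
      parents are neighbours of \<open>s\<close> and form a clique; the parents of all other
      vertices stay the same.\<close>
    let ?L = "L \<union> V \<times> {s}"
    have Lsub: "L \<subseteq> ?W \<times> ?W" and lin: "linear_order_on ?W L"
      using L by (auto simp: simplicial_ordering_def order_on_defs refl_on_def)
    have "linear_order_on V ?L"
      using lin Lsub sV
      unfolding order_on_defs refl_on_def trans_def antisym_def total_on_def by blast
    moreover have "clique V E (insert v (parents E ?L v))" if "v \<in> V" for v
    proof (cases "v = s")
      case True
      have "parents E ?L s \<subseteq> {a \<in> V. (s, a) \<in> E}"
        using Lsub \<open>sym E\<close> by (auto simp: parents_def dest: symD)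
      then show ?thesis
        using s True \<open>sym E\<close>[THEN symD] unfolding clique_def simplicial_def by blast
    next
      case False
      then have "parents E ?L v = parents E L v" by (auto simp: parents_def)
      moreover have "clique ?W E (insert v (parents E L v))"
        using L False that by (simp add: simplicial_ordering_def)
      ultimately show ?thesis by (auto simp: clique_def)
    qed
    ultimately show ?thesis unfolding simplicial_ordering_def by blast
  qed
qed

section \<open>Legal colours\<close>

lemma card_clique_le_clique_number:
  assumes "finite V" "clique V E S"
  shows "card S \<le> clique_number V E"
proof -
  have "{S. clique V E S} \<subseteq> Pow V" by (auto simp: clique_def)
  then have "finite {S. clique V E S}" using assms(1) by (meson finite_Pow_iff finite_subset)
  then show ?thesis unfolding clique_number_def using assms(2) by simp
qed

definition colored_nbrs :: "('a \<times> 'a) set \<Rightarrow> 'a history \<Rightarrow> 'a \<Rightarrow> 'a set" where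
  "colored_nbrs E h v = {u. (u, v) \<in> E \<and> map_of h u \<noteq> None}"

lemma finite_colored_nbrs: "finite (colored_nbrs E h v)"
  by (rule finite_subset[OF _ finite_dom_map_of[of h]]) (auto simp: colored_nbrs_def)

text \<open>Pigeonhole: every blocked colour occupies \<open>k\<close> coloured neighbours of
  \<open>v\<close>, and these sets are disjoint for different colours, so \<open>n\<close> blocked
  colours need \<open>n * k\<close> coloured neighbours.\<close>

lemma ex_legal_color:
  assumes "k > 0" and p: "play V E k n h" and v: "v \<in> uncolored V h"
    and less: "card (colored_nbrs E h v) < n * k"
  shows "\<exists>d. legal_move V E k n h (v, d)"
proof (rule ccontr)
  assume none: "\<nexists>d. legal_move V E k n h (v, d)"
  let ?M = "\<lambda>d. {u \<in> colored_nbrs E h v. map_of h u = Some d}"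
  have v: "v \<in> V" "map_of h v = None" using v by (auto simp: uncolored_def)
  have fin: "finite (?M d)" for d using finite_colored_nbrs by (rule finite_subset[rotated]) auto
  have blocked: "k \<le> card (?M d)" if "d < n" for d
  proof -
    obtain S where S: "monochromatic_clique V E ((map_of h)(v \<mapsto> d)) S" "card S = k + 1"
      using none v \<open>d < n\<close> by (auto simp: legal_move_def)
    then obtain e where e: "clique V E S" "\<forall>x\<in>S. ((map_of h)(v \<mapsto> d)) x = Some e"
      by (auto simp: monochromatic_clique_def)
    \<comment> \<open>A clique avoiding \<open>v\<close> would have been monochromatic before the
      move, which no play allows.\<close>
    have "v \<in> S"
    proof (rule ccontr)
      assume "v \<notin> S"
      then have "monochromatic_clique V E (map_of h) S"
        using e by (auto simp: monochromatic_clique_def intro!: exI[of _ e] split: if_splits)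
      then show False using play_no_monochromatic[OF p \<open>k > 0\<close>] S by blast
    qed
    then have "e = d" using e by auto
    then have "S - {v} \<subseteq> ?M d"
      using e \<open>v \<in> S\<close> by (auto simp: colored_nbrs_def clique_def split: if_splits)
    then have "card (S - {v}) \<le> card (?M d)"
      using fin by (intro card_mono) auto
    then show ?thesis using S(2) \<open>v \<in> S\<close> by simp
  qed
  have "n * k = (\<Sum>d<n. k)" by simp
  also have "\<dots> \<le> (\<Sum>d<n. card (?M d))" using blocked by (intro sum_mono) auto
  also have "\<dots> = card (\<Union>d<n. ?M d)"
    using fin by (subst card_UN_disjoint) auto
  also have "\<dots> \<le> card (colored_nbrs E h v)"
    using finite_colored_nbrs by (intro card_mono) auto
  finally show False using less by simp
qed

lemma uncolored_snoc: "uncolored V (h @ [(b, e)]) = uncolored V h - {b}"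
  by (auto simp: uncolored_def map_add_def split: option.splits)

lemma play_snocD:
  assumes "play V E k n (h @ [m])"
  shows "play V E k n h \<and> \<not> finished V E k n h \<and> legal_move V E k n h m"
  using assms by (cases rule: play.cases) auto

lemma follows_snoc:
  "follows \<sigma> (h @ [m]) \<longleftrightarrow> follows \<sigma> h \<and> (even (length h) \<longrightarrow> m = \<sigma> h)"
  unfolding follows_def by (auto simp: nth_append less_Suc_eq)

lemma sum_add_of_bool:
  assumes "finite S"
  shows "(\<Sum>u\<in>S. g u + of_bool (u = x)) = (\<Sum>u\<in>S. g u) + (of_bool (x \<in> S) :: nat)"
  using assms by (simp add: sum.distrib of_bool_def)

section \<open>The invariant of the Activation Strategy\<close>

locale simplicially_ordered_graph =
  fixes V :: "'a set" and E L :: "('a \<times> 'a) set"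
  assumes finite_V: "finite V" and graph: "simple_graph V E"
    and ordering: "simplicial_ordering V E L"
begin

abbreviation N :: "'a \<Rightarrow> 'a set" where
  "N v \<equiv> insert v (parents E L v)"

definition children :: "'a \<Rightarrow> 'a set" where
  "children v = {x. v \<in> parents E L x}"

text \<open>
  Alice's loop visits a vertex at most twice: the first visit activates it, the second one
  colours it. So the following sum bounds the number of visits to \<open>N\<^sup>+[v]\<close> so far, where \<open>U\<close>
  and \<open>A\<close> are the uncoloured and the active vertices.
\<close>

definition visits :: "'a set \<Rightarrow> 'a set \<Rightarrow> 'a \<Rightarrow> nat" where
  "visits U A v = (\<Sum>u\<in>N v. of_bool (u \<in> A) + of_bool (u \<notin> U))"

text \<open>
  The set \<open>P\<close> is empty between Alice's turns, and \<open>{x}\<close> while she is about to visit \<open>x\<close>.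
\<close>

definition balanced :: "'a set \<Rightarrow> 'a set \<Rightarrow> 'a set \<Rightarrow> bool" where
  "balanced U A P \<longleftrightarrow>
     (\<forall>v\<in>U. card (A \<inter> children v) \<le> visits U A v + of_bool (P \<inter> N v \<noteq> {}))"

section \<open>Parents, children and least vertices\<close>

lemma E_subset: "E \<subseteq> V \<times> V" and symE: "(a, b) \<in> E \<Longrightarrow> (b, a) \<in> E" and irreflE: "(a, a) \<notin> E"
  using graph by (auto simp: simple_graph_def irrefl_def dest: symD)

lemma finite_parents: "finite (parents E L v)"
  by (rule finite_subset[OF _ finite_V]) (use E_subset in \<open>auto simp: parents_def\<close>)

lemma finite_children: "finite (children v)"
  by (rule finite_subset[OF _ finite_V]) (use E_subset in \<open>auto simp: parents_def children_def\<close>)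

lemma clique_N: "v \<in> V \<Longrightarrow> clique V E (N v)"
  using ordering by (simp add: simplicial_ordering_def)

lemma card_parents_less: "v \<in> V \<Longrightarrow> card (parents E L v) < clique_number V E"
  using card_clique_le_clique_number[OF finite_V clique_N, of v] finite_parents[of v]
  by (simp add: parents_def)

lemma total_L: "u \<in> V \<Longrightarrow> v \<in> V \<Longrightarrow> (u, v) \<in> L \<or> (v, u) \<in> L"
  using ordering
  by (cases "u = v") (auto simp: simplicial_ordering_def order_on_defs refl_on_def total_on_def)

lemma ex_least_of:
  assumes "S \<subseteq> V" "S \<noteq> {}"
  shows "\<exists>x. least_of L S x"
proof -
  have "finite S" using assms finite_V finite_subset by blast
  then show ?thesis using assms(2,1)
  proof (induction rule: finite_ne_induct)
    case (singleton x)
    then show ?case using total_L[of x x] by (auto simp: least_of_def)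
  next
    case (insert x F)
    then obtain y where y: "least_of L F y" by auto
    have "trans L" using ordering by (simp add: simplicial_ordering_def order_on_defs)
    show ?case
    proof (cases "(x, y) \<in> L")
      case True
      then have "least_of L (insert x F) x"
        using y insert.prems total_L[of x x] \<open>trans L\<close> by (auto simp: least_of_def dest: transD)
      then show ?thesis ..
    next
      case False
      then have "least_of L (insert x F) y"
        using y insert.prems total_L[of x y] by (auto simp: least_of_def)
      then show ?thesis ..
    qed
  qed
qed

section \<open>Counting visits\<close>

lemma visits_activate:
  assumes "x \<notin> A"
  shows "visits U (insert x A) v = visits U A v + of_bool (x \<in> N v)"
proof -
  have "visits U (insert x A) v = (\<Sum>u\<in>N v. (of_bool (u \<in> A) + of_bool (u \<notin> U)) + of_bool (u = x))"
    unfolding visits_def using assms by (intro sum.cong) (auto simp: of_bool_def)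
  also have "\<dots> = visits U A v + of_bool (x \<in> N v)"
    unfolding visits_def by (rule sum_add_of_bool) (simp add: finite_parents)
  finally show ?thesis .
qed

lemma visits_color:
  assumes "x \<in> U"
  shows "visits (U - {x}) A v = visits U A v + of_bool (x \<in> N v)"
proof -
  have "visits (U - {x}) A v = (\<Sum>u\<in>N v. (of_bool (u \<in> A) + of_bool (u \<notin> U)) + of_bool (u = x))"
    unfolding visits_def using assms by (intro sum.cong) (auto simp: of_bool_def)
  also have "\<dots> = visits U A v + of_bool (x \<in> N v)"
    unfolding visits_def by (rule sum_add_of_bool) (simp add: finite_parents)
  finally show ?thesis .
qed

lemma visits_mono:
  assumes "A \<subseteq> A'" "U' \<subseteq> U"
  shows "visits U A v \<le> visits U' A' v"
  unfolding visits_def using assms by (intro sum_mono) (auto simp: of_bool_def)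

text \<open>Each parent counts at most twice, while the uncoloured \<open>v\<close> itself can only
  have been activated.\<close>

lemma visits_le:
  assumes "v \<in> U"
  shows "visits U A v \<le> 2 * card (parents E L v) + 1"
proof -
  let ?g = "\<lambda>u. of_bool (u \<in> A) + of_bool (u \<notin> U) :: nat"
  have "visits U A v = ?g v + (\<Sum>u\<in>parents E L v. ?g u)"
    unfolding visits_def using finite_parents by (rule sum.insert) (simp add: parents_def)
  also have "\<dots> \<le> 1 + (\<Sum>u\<in>parents E L v. 2)"
    using assms by (intro add_mono sum_mono) (auto simp: of_bool_def)
  finally show ?thesis by simp
qed

text \<open>The uncoloured parent \<open>v\<close> is itself a candidate, so the mother
  \<open>m\<close> does not come after \<open>v\<close>; both lie in the clique \<open>N b\<close>,
  so \<open>m\<close> is \<open>v\<close> or a parent of \<open>v\<close>.\<close>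

lemma mother_in_N:
  assumes "is_mother E L U b m" "b \<in> children v" "v \<in> U"
  shows "m \<in> N v"
proof -
  have b: "b \<in> V" "v \<in> N b" using assms(2) E_subset by (auto simp: children_def parents_def)
  then have mv: "(m, v) \<in> L" "m \<in> N b"
    using assms by (auto simp: is_mother_def least_of_def mother_candidates_def)
  show ?thesis
  proof (cases "m = v")
    case False
    then have "(m, v) \<in> E"
      using clique_N[OF b(1)] b(2) mv(2) unfolding clique_def by metis
    then show ?thesis using False mv(1) by (simp add: parents_def)
  qed simp
qed

section \<open>Preservation of the balance\<close>

lemma card_insert_children:
  "card (insert b A \<inter> children v) \<le> card (A \<inter> children v) + of_bool (b \<in> children v)"
  by (cases "b \<in> children v") (simp_all add: card_insert_if finite_children)

text \<open>The pending visit to \<open>x\<close> becomes a counted one. If \<open>x\<close> is a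
  new active child of \<open>v\<close>, the pending visit to its mother, which lies in
  \<open>N v\<close>, pays for it.\<close>

lemma balanced_activate:
  assumes "balanced U A {x}" "x \<notin> A" "is_mother E L U x m"
  shows "balanced U (insert x A) {m}"
  unfolding balanced_def
proof
  fix v assume v: "v \<in> U"
  have "card (insert x A \<inter> children v) \<le> card (A \<inter> children v) + of_bool (x \<in> children v)"
    by (rule card_insert_children)
  also have "\<dots> \<le> visits U A v + of_bool (x \<in> N v) + of_bool (m \<in> N v)"
    using assms(1) v mother_in_N[OF assms(3) _ v]
    by (intro add_mono) (auto simp: balanced_def of_bool_def)
  finally show "card (insert x A \<inter> children v) \<le>
      visits U (insert x A) v + of_bool ({m} \<inter> N v \<noteq> {})"
    unfolding visits_activate[OF assms(2)] by (auto simp: of_bool_def split: if_splits)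
qed

text \<open>Besides Bob's moves this covers Alice's moves outside her loop. With
  \<open>P = {}\<close> the last premise says that no vertex left uncoloured has \<open>b\<close> as
  a child.\<close>

lemma balanced_bob:
  assumes "balanced U A {}" and U': "U' = U - {b}"
    and "\<And>v. v \<in> U' \<Longrightarrow> b \<in> children v \<Longrightarrow> P \<inter> N v \<noteq> {}"
  shows "balanced U' (insert b A) P"
  unfolding balanced_def
proof
  fix v assume v: "v \<in> U'"
  have "card (insert b A \<inter> children v) \<le> card (A \<inter> children v) + of_bool (b \<in> children v)"
    by (rule card_insert_children)
  also have "\<dots> \<le> visits U A v + of_bool (P \<inter> N v \<noteq> {})"
    using assms v by (intro add_mono) (auto simp: balanced_def of_bool_def)
  also have "visits U A v \<le> visits U' (insert b A) v"
    using U' by (intro visits_mono) auto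
  finally show "card (insert b A \<inter> children v) \<le> visits U' (insert b A) v + of_bool (P \<inter> N v \<noteq> {})"
    by simp
qed

lemma balanced_color:
  assumes "balanced U A {x}" "x \<in> U"
  shows "balanced (U - {x}) A {}"
  using assms unfolding balanced_def by (auto simp: visits_color)

text \<open>Each round hands the pending visit on to the mother, and the final colouring turns it
  into a counted visit. That \<open>y\<close> and \<open>A\<close> lie in \<open>A'\<close> keeps
  all coloured vertices active.\<close>

lemma chase_balanced:
  assumes "chase E L U A x A' y" "x \<in> U" "balanced U A {x}"
  shows "y \<in> U \<and> y \<in> A' \<and> A \<subseteq> A' \<and> balanced (U - {y}) A' {}"
  using assms
proof (induction rule: chase.induct)
  case (active x A)
  then show ?case using balanced_color by blast
next
  case (inactive x A m A' y)
  have "m \<in> U" using inactive.hyps(2) by (auto simp: is_mother_def least_of_def mother_candidates_def)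
  then show ?case using inactive balanced_activate by blast
qed

lemma activation_run_balanced:
  assumes "activation_run V E L h A"
  shows "V - uncolored V h \<subseteq> A \<and> balanced (uncolored V h) A {}"
  using assms
proof (induction rule: activation_run.induct)
  case (first v d)
  have U: "uncolored V [(v, d)] = V - {v}" by (auto simp: uncolored_def)
  have "balanced V {} {}" by (simp add: balanced_def)
  then have "balanced (V - {v}) {v} {}"
  proof (rule balanced_bob)
    \<comment> \<open>The least vertex has no parents, so it is nobody's child.\<close>
    fix w assume w: "w \<in> V - {v}" "v \<in> children w"
    then have "(w, v) \<in> L" "(v, w) \<in> L" "w \<noteq> v"
      using first by (auto simp: least_of_def children_def parents_def)
    then show "{} \<inter> N w \<noteq> {}"
      using ordering by (auto simp: simplicial_ordering_def order_on_defs dest: antisymD)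
  qed simp
  then show ?case unfolding U by auto
next
  case (no_mother h A U b e v d)
  have U: "U = uncolored V h - {b}" using no_mother.hyps(2) by (simp add: uncolored_snoc)
  have U2: "uncolored V (h @ [(b, e), (v, d)]) = U - {v}"
    unfolding no_mother.hyps(2) using uncolored_snoc[of V "h @ [(b, e)]" v d] by simp
  have "balanced U (insert b A) {}"
    using no_mother.IH no_mother.hyps(3) U
    by (intro balanced_bob) (auto simp: mother_candidates_def children_def)
  then have "balanced (U - {v}) (insert v (insert b A)) {}"
  proof (rule balanced_bob)
    \<comment> \<open>An uncoloured parent \<open>w\<close> of \<open>v\<close> would precede the
      least uncoloured vertex.\<close>
    fix w assume w: "w \<in> U - {v}" "v \<in> children w"
    then have "(w, v) \<in> L" "(v, w) \<in> L" "w \<noteq> v"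
      using no_mother.hyps(4) by (auto simp: least_of_def children_def parents_def)
    then show "{} \<inter> N w \<noteq> {}"
      using ordering by (auto simp: simplicial_ordering_def order_on_defs dest: antisymD)
  qed simp
  then show ?case unfolding U2 using no_mother.IH U by auto
next
  case (mother h A U b e x A' y d)
  have U: "U = uncolored V h - {b}" using mother.hyps(2) by (simp add: uncolored_snoc)
  have U2: "uncolored V (h @ [(b, e), (y, d)]) = U - {y}"
    unfolding mother.hyps(2) using uncolored_snoc[of V "h @ [(b, e)]" y d] by simp
  have "balanced U (insert b A) {x}"
    using mother.IH U mother_in_N[OF mother.hyps(3)] by (intro balanced_bob) auto
  moreover have "x \<in> U"
    using mother.hyps(3) by (auto simp: is_mother_def least_of_def mother_candidates_def)
  ultimately have "y \<in> U \<and> y \<in> A' \<and> insert b A \<subseteq> A' \<and> balanced (U - {y}) A' {}"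
    using chase_balanced[OF mother.hyps(4)] by blast
  then show ?case unfolding U2 using mother.IH U by auto
qed

text \<open>Coloured neighbours are parents or active children. With at most \<omega> - 1 parents
  this gives (\<omega> - 1) + 2(\<omega> - 1) + 1 = 3\<omega> - 2, leaving room for one reply of
  Bob.\<close>

lemma card_colored_nbrs_le:
  assumes run: "activation_run V E L h A" and v: "v \<in> uncolored V h"
  shows "card (colored_nbrs E h v) + 2 \<le> 3 * clique_number V E"
proof -
  note inv = activation_run_balanced[OF run]
  have vV: "v \<in> V" using v by (simp add: uncolored_def)
  have "u \<in> parents E L v \<union> (A \<inter> children v)" if u: "u \<in> colored_nbrs E h v" for u
  proof -
    have uE: "(u, v) \<in> E" and uA: "u \<in> A" "u \<in> V"
      using u inv E_subset by (auto simp: colored_nbrs_def uncolored_def)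
    moreover have "u \<noteq> v" using uE irreflE by auto
    ultimately show ?thesis using total_L[OF \<open>u \<in> V\<close> vV] symE[OF uE]
      by (auto simp: parents_def children_def)
  qed
  then have "card (colored_nbrs E h v) \<le> card (parents E L v \<union> (A \<inter> children v))"
    using finite_parents finite_children by (intro card_mono) auto
  also have "\<dots> \<le> card (parents E L v) + card (A \<inter> children v)" by (rule card_Un_le)
  also have "\<dots> \<le> card (parents E L v) + (2 * card (parents E L v) + 1)"
    using inv v visits_le[OF v, of A] by (intro add_mono) (auto simp: balanced_def)
  finally show ?thesis using card_parents_less[OF vV] by linarith
qed

text \<open>Each inactive round activates a new vertex, so \<open>V - A\<close> shrinks. The loop
  cannot get stuck, since an uncoloured \<open>x\<close> is a candidate for its own mother.\<close>

lemma ex_chase: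
  assumes "U \<subseteq> V" "x \<in> U"
  shows "\<exists>A' y. y \<in> U \<and> chase E L U A x A' y"
  using assms(2)
proof (induction "card (V - A)" arbitrary: A x rule: less_induct)
  case less
  show ?case
  proof (cases "x \<in> A")
    case True
    then show ?thesis using less.prems chase.active by metis
  next
    case False
    have "x \<in> mother_candidates E L U x" "mother_candidates E L U x \<subseteq> V"
      using less.prems assms(1) by (auto simp: mother_candidates_def)
    then obtain m where m: "is_mother E L U x m"
      unfolding is_mother_def using ex_least_of by blast
    then have "m \<in> U" by (auto simp: is_mother_def least_of_def mother_candidates_def)
    moreover have "card (V - insert x A) < card (V - A)"
      using False less.prems assms(1) finite_V by (intro psubset_card_mono) auto
    ultimately obtain A' y where "y \<in> U" "chase E L U (insert x A) m A' y"
      using less.hyps by blast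
    then show ?thesis using chase.inactive[OF False m] by blast
  qed
qed

text \<open>The vertex is fixed before the colour \<open>d\<close>, so any legal colour can be
  chosen for it afterwards.\<close>

lemma ex_activation_vertex:
  assumes run: "activation_run V E L h A" and ne: "uncolored V (h @ [(b, e)]) \<noteq> {}"
  shows "\<exists>v\<in>uncolored V (h @ [(b, e)]). \<forall>d. \<exists>A'. activation_run V E L ((h @ [(b, e)]) @ [(v, d)]) A'"
proof -
  let ?U = "uncolored V (h @ [(b, e)])"
  have UV: "?U \<subseteq> V" by (auto simp: uncolored_def)
  show ?thesis
  proof (cases "mother_candidates E L ?U b = {}")
    case True
    obtain v where v: "least_of L ?U v" using ex_least_of[OF UV ne] by blast
    show ?thesis
    proof (intro bexI[of _ v] allI exI)
      show "activation_run V E L ((h @ [(b, e)]) @ [(v, d)]) (insert v (insert b A))" for d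
        using activation_run.no_mother[OF run refl True v, of d] by simp
    qed (use v in \<open>auto simp: least_of_def\<close>)
  next
    case False
    then obtain x where x: "is_mother E L ?U b x"
      using ex_least_of[OF _ False] UV by (auto simp: is_mother_def mother_candidates_def)
    then have "x \<in> ?U" by (auto simp: is_mother_def least_of_def mother_candidates_def)
    then obtain A' y where y: "y \<in> ?U" "chase E L ?U (insert b A) x A' y"
      using ex_chase[OF UV] by blast
    show ?thesis
    proof (intro bexI[of _ y] allI exI)
      show "activation_run V E L ((h @ [(b, e)]) @ [(y, d)]) A'" for d
        using activation_run.mother[OF run refl x y(2), of d] by simp
    qed (use y in simp)
  qed
qed

section \<open>Winning with the Activation Strategy\<close>

lemma activation_strategy_winning:
  assumes "k > 0" and ck: "3 * clique_number V E \<le> c * k" and "c > 0"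
    and \<sigma>: "activation_strategy V E k c L \<sigma>"
  shows "winning_strategy V E k c \<sigma>"
proof -
  have odd_run: "\<exists>A. activation_run V E L h A"
    if h: "play V E k c h" "follows \<sigma> h" "odd (length h)" for h
  proof -
    obtain h' m where h': "h = h' @ [m]" using h(3) by (cases h rule: rev_cases) auto
    then have "m = \<sigma> h'" using h by (simp add: follows_snoc)
    moreover have "play V E k c h'" "\<not> finished V E k c h'" "follows \<sigma> h'" "even (length h')"
      using play_snocD[of V E k c h' m] h unfolding h' follows_snoc by simp_all
    ultimately show ?thesis using \<sigma> unfolding activation_strategy_def h' by blast
  qed
  have "\<exists>d. legal_move V E k c h (v, d)"
    if h: "play V E k c h" "follows \<sigma> h" and v: "v \<in> uncolored V h" for h v
  proof (rule ex_legal_color[OF \<open>k > 0\<close> h(1) v])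
    \<comment> \<open>The bound is checked on the empty board, after a move of Alice, and after a
      reply of Bob; the last adds at most one coloured neighbour, namely \<open>b\<close>.\<close>
    consider "h = []" | "odd (length h)" | h' b e where "h = h' @ [(b, e)]" "odd (length h')"
      by (cases h rule: rev_cases) auto
    then show "card (colored_nbrs E h v) < c * k"
    proof cases
      case 1
      then show ?thesis using \<open>k > 0\<close> \<open>c > 0\<close> by (simp add: colored_nbrs_def)
    next
      case 2
      then obtain A where "activation_run V E L h A" using odd_run[OF h] by blast
      then show ?thesis using card_colored_nbrs_le[OF _ v] ck by fastforce
    next
      case (3 h' b e)
      then obtain A where A: "activation_run V E L h' A"
        using odd_run[of h'] h play_snocD[of V E k c h' "(b, e)"] by (auto simp: follows_snoc)
      have v': "v \<in> uncolored V h'" using v 3 by (simp add: uncolored_snoc)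
      have "colored_nbrs E h v \<subseteq> insert b (colored_nbrs E h' v)"
        using 3 by (auto simp: colored_nbrs_def map_add_def split: option.splits if_splits)
      then have "card (colored_nbrs E h v) \<le> card (insert b (colored_nbrs E h' v))"
        using finite_colored_nbrs by (intro card_mono) auto
      also have "\<dots> \<le> Suc (card (colored_nbrs E h' v))"
        by (simp add: card_insert_if finite_colored_nbrs)
      finally show ?thesis using card_colored_nbrs_le[OF A v'] ck by linarith
    qed
  qed
  then have "\<not> bob_won V E k c h" if "play V E k c h" "follows \<sigma> h" for h
    using that unfolding bob_won_def by blast
  then show ?thesis
    using \<sigma> unfolding winning_strategy_def activation_strategy_def finished_def by blast
qed

text \<open>A good move is chosen at every history independently. That one exists at
  \<open>h\<close> requires an activation run two moves earlier, hence the strong induction on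
  length along plays following the same choice.\<close>

lemma ex_activation_strategy: "\<exists>\<sigma>. activation_strategy V E k c L \<sigma>"
proof
  let ?good = "\<lambda>h m. legal_move V E k c h m \<and> (\<exists>A. activation_run V E L (h @ [m]) A)"
  let ?s = "\<lambda>h. SOME m. ?good h m"
  have "?good h (?s h)"
    if "play V E k c h" "follows ?s h" "even (length h)" "\<not> finished V E k c h" for h
    using that
  proof (induction h rule: length_induct)
    case (1 h)
    have ne: "uncolored V h \<noteq> {}"
      and legal: "\<And>v. v \<in> uncolored V h \<Longrightarrow> \<exists>d. legal_move V E k c h (v, d)"
      using 1(5) by (auto simp: finished_def alice_won_def bob_won_def)
    have "\<exists>v\<in>uncolored V h. \<forall>d. \<exists>A. activation_run V E L (h @ [(v, d)]) A"
    proof (cases h rule: rev_cases)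
      case Nil
      then have U: "uncolored V h = V" by (simp add: uncolored_def)
      obtain v where v: "least_of L V v" using ex_least_of[of V] ne U by auto
      then have "v \<in> V" by (simp add: least_of_def)
      then show ?thesis using activation_run.first[OF v] Nil U by (metis append_Nil)
    next
      case (snoc h1 m)
      obtain b e where m: "m = (b, e)" by fastforce
      have "odd (length h1)" using 1(4) snoc by simp
      then obtain h0 m0 where h1: "h1 = h0 @ [m0]" by (cases h1 rule: rev_cases) auto
      have p: "play V E k c h1" "follows ?s h1"
        using 1(2,3) play_snocD[of V E k c h1 m] unfolding snoc follows_snoc by blast+
      have "even (length h0)" using \<open>odd (length h1)\<close> h1 by simp
      have p0: "play V E k c h0" "\<not> finished V E k c h0" "follows ?s h0" "m0 = ?s h0"
        using p play_snocD[of V E k c h0 m0] \<open>even (length h0)\<close> unfolding h1 follows_snoc by blast+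
      have "?good h0 (?s h0)"
        using 1(1) p0 \<open>even (length h0)\<close> snoc h1 by simp
      then obtain A where "activation_run V E L h1 A" using p0(4) h1 by blast
      then show ?thesis using ex_activation_vertex ne unfolding snoc m by blast
    qed
    then have "\<exists>m. ?good h m" using legal by blast
    then show ?case by (rule someI_ex)
  qed
  then show "activation_strategy V E k c L ?s" unfolding activation_strategy_def by blast
qed

end

theorem theorem3p8:
  fixes c k \<omega> :: nat and V :: "'a set" and E :: "('a \<times> 'a) set"
  assumes "c > 0" and "k > 0" and "\<omega> > 0"
    and "int c * int k - 3 * int \<omega> + 1 > 0"
    and "\<omega> > k"
    and "finite V" and "simple_graph V E"
    and "chordal V E"
    and "clique_number V E = \<omega>"
  shows "(\<exists>L. simplicial_ordering V E L) \<and>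
    (\<forall>L. simplicial_ordering V E L \<longrightarrow>
       (\<exists>\<sigma>. activation_strategy V E k c L \<sigma>) \<and>
       (\<forall>\<sigma>. activation_strategy V E k c L \<sigma> \<longrightarrow> winning_strategy V E k c \<sigma>)) \<and>
    int (game_chromatic_number k V E) \<le> \<lfloor>(3 * real \<omega> - 1) / real k\<rfloor> + 1"
proof (intro conjI allI impI)
  show "\<exists>L. simplicial_ordering V E L"
    using assms ex_simplicial_ordering by (auto simp: simple_graph_def)
  fix L assume "simplicial_ordering V E L"
  then interpret simplicially_ordered_graph V E L using assms by unfold_locales
  show "\<exists>\<sigma>. activation_strategy V E k c L \<sigma>" by (rule ex_activation_strategy)
  fix \<sigma> assume "activation_strategy V E k c L \<sigma>"
  \<comment> \<open>Over the integers, the hypothesis \<open>c k - 3 \<omega> + 1 > 0\<close> means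
    exactly \<open>3 \<omega> \<le> c k\<close>.\<close>
  moreover have "int (3 * \<omega>) \<le> int (c * k)" using assms(4) by simp
  then have "3 * \<omega> \<le> c * k" by (simp only: of_nat_le_iff)
  ultimately show "winning_strategy V E k c \<sigma>"
    using activation_strategy_winning assms by simp
next
  obtain L where "simplicial_ordering V E L"
    using assms ex_simplicial_ordering by (metis simple_graph_def)
  then interpret simplicially_ordered_graph V E L using assms by unfold_locales
  \<comment> \<open>The least number of colours whose product with \<open>k\<close> exceeds
    \<open>3 * \<omega> - 1\<close>; the subtraction is exact because \<omega> is positive.\<close>
  let ?n = "(3 * \<omega> - 1) div k + 1"
  have "3 * \<omega> - 1 < ?n * k"
    using dividend_less_div_times[OF \<open>k > 0\<close>, of "3 * \<omega> - 1"] by (simp add: algebra_simps)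
  then have "3 * clique_number V E \<le> ?n * k" using assms by linarith
  then have "\<exists>\<sigma>. winning_strategy V E k ?n \<sigma>"
    using activation_strategy_winning[OF \<open>k > 0\<close>] ex_activation_strategy[of k ?n] by fastforce
  then have "game_chromatic_number k V E \<le> ?n"
    unfolding game_chromatic_number_def by (rule Least_le)
  moreover have "\<lfloor>(3 * real \<omega> - 1) / real k\<rfloor> = int ((3 * \<omega> - 1) div k)"
  proof -
    have eq: "3 * real \<omega> - 1 = real (3 * \<omega> - 1)" using assms by simp
    show ?thesis unfolding eq by (rule floor_divide_of_nat_eq)
  qed
  ultimately show "int (game_chromatic_number k V E) \<le> \<lfloor>(3 * real \<omega> - 1) / real k\<rfloor> + 1"
    by simp
qed

end
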